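(* Consider the fully composite problem $\varphi^*=\min_{x\in\operatorname{dom}\varphi}\{\varphi(x)=F(x,f(x))\}$ with subhomogeneous outer function (see context). For the iterations of the Fully Composite Contracting Proximal-Point Scheme described in the context, for all $k\ge1$, it holds $$A_k(\varphi(x_k)-\varphi^* )+\rho_d(v_k;x^* )\ \le\ O\Big(\rho_d(x_0;x^* )+k^3\delta+k^3\delta^{1/2}\rho_d(x_0;x^* )^{1/2}\Big).$$ Hence, $$\varphi(x_k)-\varphi^*\ \le\ O\Big(\frac{\rho_d(x_0;x^* )}{k^3}+\delta+\delta^{1/2}\rho_d(x_0;x^* )^{1/2}\Big).$$ And to solve the initial problem with $\varepsilon$-accuracy, we need to pick $$\delta\ \approx\ \min\Big\{\varepsilon,\ \frac{\varepsilon^2}{\rho_d(x_0;x^* )}\Big\}.$$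
   Context: $\mathbb{E}$ is a finite-dimensional real vector space with norm $\|x\|=\langle Bx,x\rangle^{1/2}$, where $B:\mathbb{E}\to\mathbb{E}^*$ is self-adjoint positive definite. $O(\cdot)$ hides absolute constants, and $\approx$ means equality up to an absolute constant factor. Fully composite problem: $F:\mathbb{E}\times\mathbb{R}^m\to\mathbb{R}\cup\{+\infty\}$ is closed and convex on its domain, and for any $x\in\mathbb{E}$ for which $\mathcal{D}(x)=\{u\in\mathbb{R}^m:F(x,u)<+\infty\}$ is nonempty, $F(x,\cdot)$ is closed, convex and monotone on $\mathcal{D}(x)$ ($u\le v$ componentwise implies $F(x,u)\le F(x,v)$). $f=(f_1,\dots,f_m)^T:\operatorname{dom} f\to\mathbb{R}^m$, $\operatorname{dom} f\subseteq\mathbb{E}$ open and convex; all $f_i$ are closed, convex and twice continuously differentiable with Lipschitz continuous Hessian. $\varphi(x)=F(x,f(x))$, $\operatorname{dom}\varphi=\{x\in\operatorname{dom} f:F(x,f(x))<+\infty\}$; a solution $x^*$ with $\varphi(x^* )=\varphi^*$ is assumed to exist. Solving with $\varepsilon$-accuracy means finding $x$ with $\varphi(x)-\varphi^*\le\varepsilon$. Subhomogeneity: for any $x\in\operatorname{dom}\varphi$, $F(x,u)$ is subhomogeneous in $u\in\mathbb{R}^m$, so that $F(x,u+tv)\le F(x,u)+tF(x,v)$ for all $u,v\in\mathbb{R}^m$, $t\ge0$. $L_2(f_i)$ is a Lipschitz constant of $\nabla^2f_i$ (operator norm w.r.t. $\|\cdot\|$); $L_2(f)=(L_2(f_1),\dots,L_2(f_m))^T$;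 $F(L_2(f))=\sup_{x\in\operatorname{dom}\varphi}F(x,L_2(f))$. $\Omega_2(g,x;y)=g(x)+\langle\nabla g(x),y-x\rangle+\frac12\langle\nabla^2g(x)(y-x),y-x\rangle$ (componentwise). Prox-function: $d(x)=\frac\alpha3\|x-x_0\|^3$ with $\alpha=F(L_2(f))$, and Bregman divergence $\rho_d(x;y)=d(y)-d(x)-\langle\nabla d(x),y-x\rangle$. Scheme: choose $x_0\in\operatorname{dom}\varphi$ and $\delta>0$; set $v_0=x_0$, $A_0=0$. For $k\ge0$: (1) $A_{k+1}=\big(\frac{k+1}3\big)^3$, $\gamma_k=\frac{A_{k+1}-A_k}{A_{k+1}}$; (2) form $h_{k+1}(x)=A_{k+1}\varphi(\gamma_kx+(1-\gamma_k)x_k)+\rho_d(v_k;x)$; (3) find a point $v_{k+1}$ such that $h_{k+1}(v_{k+1})-h_{k+1}^*\le\delta$, where $h_{k+1}^*$ is the minimal value of $h_{k+1}$, by the basic Fully Composite Cubic Newton Method; (4) $x_{k+1}=\gamma_kv_{k+1}+(1-\gamma_k)x_k$. Cubic Newton Method on the subproblem: write $h_{k+1}(x)=\bar F(x,\bar f(x))$ with $\bar f(x)=f(\gamma_kx+(1-\gamma_k)x_k)$ and $\bar F(x,u)=A_{k+1}F(\gamma_kx+(1-\gamma_k)x_k,u)+\rho_d(v_k;x)$; the method iterates $z_{t+1}=\operatorname{argmin}_{x\in\operatorname{dom}\varphi}\{\bar F(x,\Omega_2(\bar f,z_t;x))+\frac M6\|x-z_t\|^3\}$, where $M=a\,\bar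 F(L_2(\bar f))$ with $a\ge1$ and $\bar F(L_2(\bar f))$ is defined for $\bar F,\bar f$ as $F(L_2(f))$ is for $F,f$. *)

theory Defs
  imports "HOL-Analysis.Analysis"
begin

section \<open>The norm induced by \<open>B\<close>\<close>

text \<open>
  The type \<^typ>\<open>'a::euclidean_space\<close> serves only as a finite-dimensional real vector space; its dual
  is \<^typ>\<open>'a \<Rightarrow>\<^sub>L real\<close>. All metric notions below refer to the norm of \<open>B\<close>, not to the norm of
  the type.
\<close>

definition self_adjoint_pos_def :: "('a::euclidean_space \<Rightarrow>\<^sub>L 'a \<Rightarrow>\<^sub>L real) \<Rightarrow> bool" where
  "self_adjoint_pos_def B \<longleftrightarrow>
     (\<forall>x y. blinfun_apply (blinfun_apply B x) y = blinfun_apply (blinfun_apply B y) x) \<and>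
     (\<forall>x. x \<noteq> 0 \<longrightarrow> blinfun_apply (blinfun_apply B x) x > 0)"

definition bnorm :: "('a::euclidean_space \<Rightarrow>\<^sub>L 'a \<Rightarrow>\<^sub>L real) \<Rightarrow> 'a \<Rightarrow> real" where
  "bnorm B x = sqrt (blinfun_apply (blinfun_apply B x) x)"

definition dual_bnorm :: "('a::euclidean_space \<Rightarrow>\<^sub>L 'a \<Rightarrow>\<^sub>L real) \<Rightarrow> ('a \<Rightarrow>\<^sub>L real) \<Rightarrow> real" where
  "dual_bnorm B s = (SUP h\<in>{h. bnorm B h \<le> 1}. blinfun_apply s h)"

definition op_bnorm ::
  "('a::euclidean_space \<Rightarrow>\<^sub>L 'a \<Rightarrow>\<^sub>L real) \<Rightarrow> ('a \<Rightarrow>\<^sub>L 'a \<Rightarrow>\<^sub>L real) \<Rightarrow> real" where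
  "op_bnorm B A = (SUP h\<in>{h. bnorm B h \<le> 1}. dual_bnorm B (blinfun_apply A h))"

section \<open>Derivatives\<close>

definition grad :: "('a::euclidean_space \<Rightarrow> real) \<Rightarrow> 'a \<Rightarrow> 'a \<Rightarrow>\<^sub>L real" where
  "grad g x = Blinfun (frechet_derivative g (at x))"

definition hess :: "('a::euclidean_space \<Rightarrow> real) \<Rightarrow> 'a \<Rightarrow> 'a \<Rightarrow>\<^sub>L 'a \<Rightarrow>\<^sub>L real" where
  "hess g x = Blinfun (frechet_derivative (grad g) (at x))"

definition twice_cont_diff_on :: "'a::euclidean_space set \<Rightarrow> ('a \<Rightarrow> real) \<Rightarrow> bool" where
  "twice_cont_diff_on S g \<longleftrightarrow>
     (\<forall>x\<in>S. g differentiable (at x)) \<and> (\<forall>x\<in>S. grad g differentiable (at x)) \<and>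
     continuous_on S (hess g)"

definition hess_lipschitz ::
  "('a::euclidean_space \<Rightarrow>\<^sub>L 'a \<Rightarrow>\<^sub>L real) \<Rightarrow> 'a set \<Rightarrow> ('a \<Rightarrow> real) \<Rightarrow> real \<Rightarrow> bool" where
  "hess_lipschitz B S g L \<longleftrightarrow>
     0 \<le> L \<and> (\<forall>x\<in>S. \<forall>y\<in>S. op_bnorm B (hess g x - hess g y) \<le> L * bnorm B (x - y))"

definition taylor2 :: "('a::euclidean_space \<Rightarrow> real^'m) \<Rightarrow> 'a \<Rightarrow> 'a \<Rightarrow> real^'m" where
  "taylor2 f x y = (\<chi> i. f x $ i + blinfun_apply (grad (\<lambda>z. f z $ i) x) (y - x)
     + 1 / 2 * blinfun_apply (blinfun_apply (hess (\<lambda>z. f z $ i) x) (y - x)) (y - x))"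

definition bregman :: "('a::euclidean_space \<Rightarrow> real) \<Rightarrow> 'a \<Rightarrow> 'a \<Rightarrow> real" where
  "bregman d x y = d y - d x - blinfun_apply (grad d x) (y - x)"

section \<open>Fully composite problems\<close>

definition ereal_epigraph :: "('b \<Rightarrow> ereal) \<Rightarrow> ('b \<times> real) set" where
  "ereal_epigraph g = {(z, t). g z \<le> ereal t}"

definition closed_convex :: "('b::real_normed_vector \<Rightarrow> ereal) \<Rightarrow> bool" where
  "closed_convex g \<longleftrightarrow> closed (ereal_epigraph g) \<and> convex (ereal_epigraph g)"

text \<open>
  Monotonicity of \<open>F x\<close> is that of an extended-valued function: \<open>u \<le> v\<close> and \<open>F x v < \<infinity>\<close> imply
  \<open>F x u \<le> F x v\<close>, so in particular \<open>F x u < \<infinity>\<close>. If only pairs with both points in the domain of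
  \<open>F x\<close> were compared, then \<open>x \<mapsto> F x (f x)\<close> could have a disconnected domain.
\<close>

definition outer_function :: "('a::euclidean_space \<Rightarrow> real^'m \<Rightarrow> ereal) \<Rightarrow> bool" where
  "outer_function F \<longleftrightarrow>
     (\<forall>x u. F x u \<noteq> -\<infinity>) \<and> closed_convex (\<lambda>(x, u). F x u) \<and>
     (\<forall>x. {u. F x u < \<infinity>} \<noteq> {} \<longrightarrow> closed_convex (F x) \<and> mono (F x))"

definition inner_function :: "('a::euclidean_space \<Rightarrow> real^'m) \<Rightarrow> 'a set \<Rightarrow> bool" where
  "inner_function f D \<longleftrightarrow> open D \<and> convex D \<and>
     (\<forall>i. closed (epigraph D (\<lambda>x. f x $ i)) \<and> convex_on D (\<lambda>x. f x $ i) \<and>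
          twice_cont_diff_on D (\<lambda>x. f x $ i))"

definition phi ::
  "('a \<Rightarrow> real^'m \<Rightarrow> ereal) \<Rightarrow> ('a \<Rightarrow> real^'m) \<Rightarrow> 'a set \<Rightarrow> 'a \<Rightarrow> ereal" where
  "phi F f D x = (if x \<in> D then F x (f x) else \<infinity>)"

definition dom_phi :: "('a \<Rightarrow> real^'m \<Rightarrow> ereal) \<Rightarrow> ('a \<Rightarrow> real^'m) \<Rightarrow> 'a set \<Rightarrow> 'a set" where
  "dom_phi F f D = {x \<in> D. F x (f x) < \<infinity>}"

definition phi_star :: "('a \<Rightarrow> real^'m \<Rightarrow> ereal) \<Rightarrow> ('a \<Rightarrow> real^'m) \<Rightarrow> 'a set \<Rightarrow> ereal" where
  "phi_star F f D = (INF x\<in>dom_phi F f D. phi F f D x)"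

definition subhomogeneous ::
  "('a \<Rightarrow> real^'m \<Rightarrow> ereal) \<Rightarrow> ('a \<Rightarrow> real^'m) \<Rightarrow> 'a set \<Rightarrow> bool" where
  "subhomogeneous F f D \<longleftrightarrow>
     (\<forall>x\<in>dom_phi F f D. \<forall>u v. \<forall>t\<ge>0. F x (u + t *\<^sub>R v) \<le> F x u + ereal t * F x v)"

definition outer_const ::
  "('a \<Rightarrow> real^'m \<Rightarrow> ereal) \<Rightarrow> ('a \<Rightarrow> real^'m) \<Rightarrow> 'a set \<Rightarrow> real^'m \<Rightarrow> ereal" where
  "outer_const F f D L = (SUP x\<in>dom_phi F f D. F x L)"

section \<open>The cubic Newton method\<close>

text \<open>\<open>X\<close> is the set over which the auxiliary problem is minimized and \<open>z T\<close> the output.\<close>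

definition cubic_newton ::
  "('a::euclidean_space \<Rightarrow>\<^sub>L 'a \<Rightarrow>\<^sub>L real) \<Rightarrow> 'a set \<Rightarrow> ('a \<Rightarrow> real^'m \<Rightarrow> ereal) \<Rightarrow>
   ('a \<Rightarrow> real^'m) \<Rightarrow> 'a set \<Rightarrow> ereal \<Rightarrow> (nat \<Rightarrow> 'a) \<Rightarrow> nat \<Rightarrow> bool" where
  "cubic_newton B X F f D M z T \<longleftrightarrow> z 0 \<in> dom_phi F f D \<and>
     (\<forall>t<T. is_arg_min (\<lambda>x. F x (taylor2 f (z t) x) + M / 6 * ereal (bnorm B (x - z t) ^ 3))
              (\<lambda>x. x \<in> X) (z (Suc t)))"

section \<open>The contracting proximal-point scheme\<close>

definition prox_fun ::
  "('a::euclidean_space \<Rightarrow>\<^sub>L 'a \<Rightarrow>\<^sub>L real) \<Rightarrow> real \<Rightarrow> 'a \<Rightarrow> 'a \<Rightarrow> real" where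
  "prox_fun B \<alpha> x0 x = \<alpha> / 3 * bnorm B (x - x0) ^ 3"

definition A_seq :: "nat \<Rightarrow> real" where
  "A_seq k = (real k / 3) ^ 3"

definition gamma_seq :: "nat \<Rightarrow> real" where
  "gamma_seq k = (A_seq (Suc k) - A_seq k) / A_seq (Suc k)"

definition contract :: "nat \<Rightarrow> 'a::real_vector \<Rightarrow> 'a \<Rightarrow> 'a" where
  "contract k y x = gamma_seq k *\<^sub>R x + (1 - gamma_seq k) *\<^sub>R y"

text \<open>The function \<open>h\<close> with index \<open>k + 1\<close>; the arguments \<open>y\<close>, \<open>w\<close> are the current points \<open>x k\<close>, \<open>v k\<close>.\<close>

definition h_fun ::
  "('a::euclidean_space \<Rightarrow> real^'m \<Rightarrow> ereal) \<Rightarrow> ('a \<Rightarrow> real^'m) \<Rightarrow> 'a set \<Rightarrow> ('a \<Rightarrow> real) \<Rightarrow>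
   nat \<Rightarrow> 'a \<Rightarrow> 'a \<Rightarrow> 'a \<Rightarrow> ereal" where
  "h_fun F f D d k y w x =
     ereal (A_seq (Suc k)) * phi F f D (contract k y x) + ereal (bregman d w x)"

definition F_bar ::
  "('a::euclidean_space \<Rightarrow> real^'m \<Rightarrow> ereal) \<Rightarrow> ('a \<Rightarrow> real) \<Rightarrow> nat \<Rightarrow> 'a \<Rightarrow> 'a \<Rightarrow>
   'a \<Rightarrow> real^'m \<Rightarrow> ereal" where
  "F_bar F d k y w x u = ereal (A_seq (Suc k)) * F (contract k y x) u + ereal (bregman d w x)"

definition f_bar :: "('a::euclidean_space \<Rightarrow> real^'m) \<Rightarrow> nat \<Rightarrow> 'a \<Rightarrow> 'a \<Rightarrow> real^'m" where
  "f_bar f k y x = f (contract k y x)"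

definition D_bar :: "'a::euclidean_space set \<Rightarrow> nat \<Rightarrow> 'a \<Rightarrow> 'a set" where
  "D_bar D k y = {x. contract k y x \<in> D}"

lemma h_fun_eq_phi_bar:
  "h_fun F f D d k y w = phi (F_bar F d k y w) (f_bar f k y) (D_bar D k y)"
proof -
  have "A_seq (Suc k) > 0" by (simp add: A_seq_def)
  then show ?thesis by (auto simp: h_fun_def phi_def F_bar_def f_bar_def D_bar_def)
qed

text \<open>
  The number \<open>T\<close> of inner steps and the inner starting point may depend on \<open>k\<close>, and \<open>Lb\<close> may be any
  vector of Lipschitz constants of the Hessians of the components of \<open>f_bar\<close>. The supremum \<open>outer_const\<close>
  for the subproblem is taken in the extended reals.
\<close>

definition found_by_cubic_newton ::
  "('a::euclidean_space \<Rightarrow>\<^sub>L 'a \<Rightarrow>\<^sub>L real) \<Rightarrow> ('a \<Rightarrow> real^'m \<Rightarrow> ereal) \<Rightarrow> ('a \<Rightarrow> real^'m) \<Rightarrow>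
   'a set \<Rightarrow> ('a \<Rightarrow> real) \<Rightarrow> real \<Rightarrow> nat \<Rightarrow> 'a \<Rightarrow> 'a \<Rightarrow> 'a \<Rightarrow> bool" where
  "found_by_cubic_newton B F f D d a k y w v' \<longleftrightarrow>
     (\<exists>Lb z T.
        (\<forall>i. hess_lipschitz B (D_bar D k y) (\<lambda>x. f_bar f k y x $ i) (Lb $ i)) \<and>
        cubic_newton B (dom_phi F f D) (F_bar F d k y w) (f_bar f k y) (D_bar D k y)
          (ereal a * outer_const (F_bar F d k y w) (f_bar f k y) (D_bar D k y) Lb) z T \<and>
        v' = z T)"

definition contracting_prox_scheme ::
  "('a::euclidean_space \<Rightarrow>\<^sub>L 'a \<Rightarrow>\<^sub>L real) \<Rightarrow> ('a \<Rightarrow> real^'m \<Rightarrow> ereal) \<Rightarrow> ('a \<Rightarrow> real^'m) \<Rightarrow>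
   'a set \<Rightarrow> ('a \<Rightarrow> real) \<Rightarrow> real \<Rightarrow> real \<Rightarrow> (nat \<Rightarrow> 'a) \<Rightarrow> (nat \<Rightarrow> 'a) \<Rightarrow> bool" where
  "contracting_prox_scheme B F f D d \<delta> a x v \<longleftrightarrow>
     x 0 \<in> dom_phi F f D \<and> v 0 = x 0 \<and>
     (\<forall>k. h_fun F f D d k (x k) (v k) (v (Suc k)) - (INF y. h_fun F f D d k (x k) (v k) y)
             \<le> ereal \<delta> \<and>
          found_by_cubic_newton B F f D d a k (x k) (v k) (v (Suc k)) \<and>
          x (Suc k) = contract k (x k) (v (Suc k)))"

section \<open>Absolute constants\<close>

text \<open>
  The constants hidden in \<open>O(\<dots>)\<close> and \<open>\<approx>\<close> must not depend on the two dimensions. These are types here,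
  and an existential quantifier inside a type-polymorphic theorem would allow such a dependence; hence
  explicit (not optimized) numbers.
\<close>

definition O_const :: real where
  "O_const = 10 ^ 4"

definition approx_const :: real where
  "approx_const = 1 / (3 * O_const) ^ 2"

text \<open>\<open>min {\<epsilon>, \<epsilon>\<^sup>2 / \<rho>}\<close>; for \<open>\<rho> = 0\<close> the extended-real quotient is \<open>\<infinity>\<close> and the minimum is \<open>\<epsilon>\<close>.\<close>

definition delta_level :: "real \<Rightarrow> real \<Rightarrow> ereal" where
  "delta_level \<epsilon> \<rho> = min (ereal \<epsilon>) (ereal (\<epsilon> ^ 2) / ereal \<rho>)"

end

theory Submission
  imports Defs
begin

text \<open>
  Write \<open>E k = A_seq k * (\<phi> (x k) - \<phi>*) + \<rho>_d (v k; x*)\<close> for the energy of the scheme, so that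
  \<open>E 0 = \<rho>_d (x 0; x*) = \<rho>0\<close>. If every proximal step were exact, optimality of \<open>v (k + 1)\<close> for
  \<open>h\<close> and convexity of \<open>\<phi>\<close> along the contraction would give \<open>E (k + 1) \<le> E k\<close>. All the work lies in
  the price of an error \<open>\<delta>\<close> in the subproblem.

  That price can be read off without the exact minimizer of the subproblem. If \<open>v'\<close> is \<open>\<delta>\<close>-optimal,
  compare it with the points \<open>v' + t (x* - v')\<close> of the segment to the solution
  (\<open>inexact_prox_step_segment\<close>). By convexity the missing first-order condition costs at most
  \<open>(\<delta> + \<rho>_d (v'; v' + t (x* - v'))) / t\<close>. Along this segment the divergence is at most quadratic, that is, at most
  \<open>t\<^sup>2 Q\<close>, and \<open>t = sqrt (\<delta> / Q)\<close> balances the two terms to \<open>2 sqrt (\<delta> Q)\<close>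
  (\<open>inexact_prox_step\<close>).

  The curvature \<open>Q\<close> of the cubic prox-function is not bounded globally: it grows with the distances of
  \<open>v'\<close> to \<open>x 0\<close> and to \<open>x*\<close>. But \<open>d\<close> is uniformly convex of degree three, so the cubes of these
  distances, multiplied by \<open>\<alpha>\<close>, are controlled by \<open>\<rho>0\<close> and by \<open>\<rho>_d (v'; x*) \<le> E (k + 1)\<close>. This gives
  \<open>Q \<le> 12 E (k + 1) + \<rho>0\<close> (\<open>bregman_prox_fun_segment\<close>) and the recurrence
  \<open>E (k + 1) \<le> E k + 2 \<delta> + 2 sqrt (\<delta> (12 E (k + 1) + \<rho>0))\<close>.

  Under this recurrence \<open>sqrt (12 E k + \<rho>0)\<close> grows by at most a multiple of \<open>sqrt \<delta>\<close> in each step, hence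
  \<open>E k\<close> is bounded by a multiple of \<open>\<rho>0 + k sqrt (\<delta> \<rho>0) + k\<^sup>2 \<delta>\<close> (\<open>energy_growth\<close>). The rate for \<open>\<phi>\<close> follows
  on division by \<open>A_seq k = k\<^sup>3 / 27\<close>, and the choice of \<open>\<delta>\<close> by making each of the three terms small.

  Subhomogeneity and monotonicity of \<open>F x\<close> make \<open>\<alpha>\<close> nonnegative (\<open>outer_const_nonneg\<close>), so that \<open>d\<close> is convex.
\<close>

section \<open>The Euclidean norm of \<open>B\<close>\<close>

lemma bnorm_nonneg:
  assumes "self_adjoint_pos_def B"
  shows "0 \<le> bnorm B x"
proof -
  have "0 \<le> blinfun_apply (blinfun_apply B x) x"
    using assms by (cases "x = 0") (auto simp: self_adjoint_pos_def_def less_imp_le)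
  then show ?thesis by (simp add: bnorm_def)
qed

lemma bnorm_power2:
  assumes "self_adjoint_pos_def B"
  shows "bnorm B x ^ 2 = blinfun_apply (blinfun_apply B x) x"
proof -
  have "0 \<le> blinfun_apply (blinfun_apply B x) x"
    using assms by (cases "x = 0") (auto simp: self_adjoint_pos_def_def less_imp_le)
  then show ?thesis by (simp add: bnorm_def)
qed

lemma bnorm_zero_iff:
  assumes "self_adjoint_pos_def B"
  shows "bnorm B x = 0 \<longleftrightarrow> x = 0"
proof
  assume "bnorm B x = 0"
  then have "blinfun_apply (blinfun_apply B x) x = 0"
    using bnorm_power2[OF assms, of x] by simp
  then show "x = 0"
    using assms unfolding self_adjoint_pos_def_def by (metis less_irrefl)
qed (simp add: bnorm_def)

lemma bnorm_scaleR: "bnorm B (c *\<^sub>R x) = \<bar>c\<bar> * bnorm B x"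
  by (simp add: bnorm_def blinfun.scaleR_left blinfun.scaleR_right real_sqrt_mult
      flip: mult.assoc)

lemma bnorm_minus_commute: "bnorm B (x - y) = bnorm B (y - x)"
  using bnorm_scaleR[of B "-1" "y - x"] by simp

lemma bnorm_add_power2:
  assumes "self_adjoint_pos_def B"
  shows "bnorm B (x + y) ^ 2 = bnorm B x ^ 2 + 2 * blinfun_apply (blinfun_apply B x) y + bnorm B y ^ 2"
proof -
  have "blinfun_apply (blinfun_apply B y) x = blinfun_apply (blinfun_apply B x) y"
    using assms by (simp add: self_adjoint_pos_def_def)
  then show ?thesis
    by (simp add: bnorm_power2[OF assms] blinfun.add_left blinfun.add_right)
qed

lemma bnorm_Cauchy_Schwarz:
  assumes "self_adjoint_pos_def B"
  shows "blinfun_apply (blinfun_apply B x) y \<le> bnorm B x * bnorm B y"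
proof (cases "x = 0 \<or> y = 0")
  case True
  then show ?thesis by (auto simp: bnorm_def)
next
  case False
  let ?a = "bnorm B x" and ?b = "bnorm B y"
  have pos: "?a > 0" "?b > 0"
    using False bnorm_nonneg[OF assms] bnorm_zero_iff[OF assms]
    by (metis less_eq_real_def)+
  \<comment> \<open>Both vectors are scaled to the common length \<open>?a * ?b\<close>; equality holds when they point the same way.\<close>
  have "0 \<le> bnorm B (?b *\<^sub>R x + (- ?a) *\<^sub>R y) ^ 2"
    by simp
  also have "\<dots> = 2 * (?a * ?b) * (?a * ?b - blinfun_apply (blinfun_apply B x) y)"
    unfolding bnorm_add_power2[OF assms] bnorm_scaleR power_mult_distrib
    by (simp add: blinfun.scaleR_left blinfun.scaleR_right blinfun.minus_right
        algebra_simps power2_eq_square)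
  finally show ?thesis
    using mult_pos_pos[OF pos] by (simp add: zero_le_mult_iff)
qed

lemma bnorm_triangle:
  assumes "self_adjoint_pos_def B"
  shows "bnorm B (x + y) \<le> bnorm B x + bnorm B y"
proof (rule power2_le_imp_le)
  show "bnorm B (x + y) ^ 2 \<le> (bnorm B x + bnorm B y) ^ 2"
    using bnorm_Cauchy_Schwarz[OF assms, of x y]
    by (simp add: bnorm_add_power2[OF assms] power2_sum)
qed (simp add: bnorm_nonneg[OF assms])

section \<open>Bregman divergence of the cubic prox-function\<close>

lemma bregman_three_points:
  "bregman d w y = bregman d w v + bregman d v y + blinfun_apply (grad d v - grad d w) (y - v)"
proof -
  have "blinfun_apply (grad d w) (y - w) =
      blinfun_apply (grad d w) (y - v) + blinfun_apply (grad d w) (v - w)"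
    by (simp add: blinfun.diff_right)
  then show ?thesis
    by (simp add: bregman_def blinfun.diff_left)
qed

text \<open>
  The cube of a norm is \<open>q * sqrt q\<close> for the quadratic form \<open>q\<close>. This outer function is differentiable
  also at \<open>0\<close>, where \<open>sqrt\<close> is not, because its difference quotient there is the continuous function
  \<open>sqrt\<close>; hence the prox-function is differentiable at its center as well.
\<close>

lemma DERIV_mult_sqrt_self:
  assumes "0 \<le> (q::real)"
  shows "((\<lambda>t. t * sqrt t) has_field_derivative 3 / 2 * sqrt q) (at q)"
proof (cases "q = 0")
  case True
  have "\<exists>g. (\<forall>z. z * sqrt z - 0 * sqrt 0 = g z * (z - 0)) \<and> isCont g 0 \<and> g 0 = 0"
    by (intro exI[of _ sqrt]) (auto intro: isCont_real_sqrt)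
  then show ?thesis using True by (simp add: CARAT_DERIV)
next
  case False
  then have "q > 0" using assms by simp
  then show ?thesis
    by (auto intro!: derivative_eq_intros simp: field_simps)
qed

lemma grad_prox_fun:
  assumes "self_adjoint_pos_def B"
  shows "grad (prox_fun B \<alpha> x0) v = (\<alpha> * bnorm B (v - x0)) *\<^sub>R blinfun_apply B (v - x0)"
proof -
  let ?q = "\<lambda>y. blinfun_apply (blinfun_apply B (y - x0)) (y - x0)"
  let ?L = "(\<alpha> * bnorm B (v - x0)) *\<^sub>R blinfun_apply B (v - x0)"
  have q_nonneg: "0 \<le> ?q y" for y
    by (metis bnorm_power2[OF assms] zero_le_power2)
  have cube: "prox_fun B \<alpha> x0 = (\<lambda>y. \<alpha> / 3 * (?q y * sqrt (?q y)))"
    using q_nonneg by (auto simp: prox_fun_def bnorm_def power3_eq_cube)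
  have sym: "blinfun_apply (blinfun_apply B h) (v - x0) = blinfun_apply (blinfun_apply B (v - x0)) h" for h
    using assms by (simp add: self_adjoint_pos_def_def)
  have dq: "(?q has_derivative (\<lambda>h. 2 * blinfun_apply (blinfun_apply B (v - x0)) h)) (at v)"
    by (auto intro!: derivative_eq_intros simp: sym)
  have "(prox_fun B \<alpha> x0 has_derivative
      (\<lambda>h. \<alpha> / 3 * (2 * blinfun_apply (blinfun_apply B (v - x0)) h * (3 / 2 * sqrt (?q v))))) (at v)"
    unfolding cube
    by (intro has_derivative_mult_right
        DERIV_compose_FDERIV[OF DERIV_mult_sqrt_self[OF q_nonneg] dq])
  also have "(\<lambda>h. \<alpha> / 3 * (2 * blinfun_apply (blinfun_apply B (v - x0)) h * (3 / 2 * sqrt (?q v))))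
      = blinfun_apply ?L"
    by (auto simp: bnorm_def blinfun.scaleR_left)
  finally have "blinfun_apply ?L = frechet_derivative (prox_fun B \<alpha> x0) (at v)"
    by (rule frechet_derivative_at)
  then show ?thesis
    by (metis grad_def blinfun_apply_inverse)
qed

text \<open>
  The gradient of \<open>d\<close> at \<open>v\<close> is a multiple of \<open>B (v - x0)\<close>, so the linear term is an inner product, and polarization
  expresses it by the three side lengths of the triangle \<open>x0, v, y\<close>. All estimates of the divergence
  thereby become inequalities between these lengths.
\<close>

lemma bregman_prox_fun:
  assumes "self_adjoint_pos_def B"
  defines "a \<equiv> \<lambda>v x0. bnorm B (v - x0)"
  shows "bregman (prox_fun B \<alpha> x0) v y =
    \<alpha> * ((a y x0 - a v x0) ^ 2 * (2 * a y x0 + a v x0) / 6 + a v x0 * a y v ^ 2 / 2)"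
proof -
  have "a y x0 ^ 2 = a v x0 ^ 2 + 2 * blinfun_apply (blinfun_apply B (v - x0)) (y - v) + a y v ^ 2"
    using bnorm_add_power2[OF assms(1), of "v - x0" "y - v"] by (simp add: a_def)
  then have cross: "blinfun_apply (blinfun_apply B (v - x0)) (y - v) =
      (a y x0 ^ 2 - a v x0 ^ 2 - a y v ^ 2) / 2"
    by simp
  show ?thesis
    unfolding bregman_def grad_prox_fun[OF assms(1)] blinfun.scaleR_left cross
    by (simp add: prox_fun_def a_def) (simp add: field_simps power2_eq_square power3_eq_cube)
qed

lemma bregman_prox_fun_center:
  assumes "self_adjoint_pos_def B"
  shows "bregman (prox_fun B \<alpha> x0) x0 y = \<alpha> / 3 * bnorm B (y - x0) ^ 3"
  unfolding bregman_prox_fun[OF assms]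
  by (simp add: bnorm_def power3_eq_cube power2_eq_square)

text \<open>
  Uniform convexity of degree three, in terms of side lengths. When \<open>s\<close> is at most \<open>3 * a\<close> the last
  term alone suffices; otherwise the triangle inequality forces \<open>b\<close> to be large, the first
  term is smallest at \<open>b = s - a\<close>, and there six times the difference of the two sides is
  \<open>(s - 2 * a) ^ 3 + 4 * a ^ 3\<close>.
\<close>

lemma cubic_bregman_lower:
  fixes a b s :: real
  assumes "0 \<le> a" "0 \<le> b" "0 \<le> s" "s \<le> a + b"
  shows "s ^ 3 / 6 \<le> (b - a) ^ 2 * (2 * b + a) / 6 + a * s ^ 2 / 2"
proof (cases "s \<le> 3 * a")
  case True
  then have "s * s ^ 2 \<le> 3 * a * s ^ 2"
    by (intro mult_right_mono) auto
  moreover have "0 \<le> (b - a) ^ 2 * (2 * b + a)"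
    using assms by simp
  ultimately show ?thesis
    by (simp add: power3_eq_cube power2_eq_square)
next
  case False
  have "(s - 2 * a) ^ 2 * (2 * s - a) \<le> (b - a) ^ 2 * (2 * b + a)"
    using assms False by (intro mult_mono power_mono) auto
  moreover have "(s - 2 * a) ^ 2 * (2 * s - a) + 3 * a * s ^ 2 - s ^ 3 = (s - 2 * a) ^ 3 + 4 * a ^ 3"
    by (simp add: power3_eq_cube power2_eq_square algebra_simps)
  moreover have "0 \<le> (s - 2 * a) ^ 3 + 4 * a ^ 3"
    using assms False by (intro add_nonneg_nonneg) auto
  ultimately show ?thesis by simp
qed

lemma bregman_prox_fun_lower:
  assumes "self_adjoint_pos_def B" "0 \<le> \<alpha>"
  shows "\<alpha> / 6 * bnorm B (y - v) ^ 3 \<le> bregman (prox_fun B \<alpha> x0) v y"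
proof -
  have "bnorm B (y - v) \<le> bnorm B (v - x0) + bnorm B (y - x0)"
    using bnorm_triangle[OF assms(1), of "y - x0" "x0 - v"]
    by (simp add: bnorm_minus_commute[of B x0 v])
  then have "\<alpha> * (bnorm B (y - v) ^ 3 / 6) \<le> bregman (prox_fun B \<alpha> x0) v y"
    unfolding bregman_prox_fun[OF assms(1)]
    by (intro mult_left_mono cubic_bregman_lower) (auto simp: bnorm_nonneg assms)
  then show ?thesis by simp
qed

lemma bregman_prox_fun_nonneg:
  assumes "self_adjoint_pos_def B" "0 \<le> \<alpha>"
  shows "0 \<le> bregman (prox_fun B \<alpha> x0) v y"
proof -
  have "0 \<le> \<alpha> / 6 * bnorm B (y - v) ^ 3"
    using assms by (simp add: bnorm_nonneg)
  then show ?thesis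
    using bregman_prox_fun_lower[OF assms, of y v x0] by linarith
qed

lemma bregman_prox_fun_upper:
  assumes "self_adjoint_pos_def B" "0 \<le> \<alpha>"
  shows "bregman (prox_fun B \<alpha> x0) v y \<le>
    \<alpha> * (bnorm B (y - v) ^ 2 * (bnorm B (v - x0) + bnorm B (y - v) / 3))"
proof -
  define a b s where "a = bnorm B (v - x0)" and "b = bnorm B (y - x0)" and "s = bnorm B (y - v)"
  have nonneg: "0 \<le> a" "0 \<le> b" "0 \<le> s"
    by (simp_all add: a_def b_def s_def bnorm_nonneg assms)
  have b_le: "b \<le> a + s" and a_le: "a \<le> b + s"
    using bnorm_triangle[OF assms(1), of "y - v" "v - x0"]
      bnorm_triangle[OF assms(1), of "v - y" "y - x0"]
    by (simp_all add: a_def b_def s_def bnorm_minus_commute[of B v y])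
  then have "(b - a) ^ 2 \<le> s ^ 2"
    by (intro abs_le_square_iff[THEN iffD1]) (use nonneg in auto)
  then have "(b - a) ^ 2 * (2 * b + a) \<le> s ^ 2 * (2 * (a + s) + a)"
    using nonneg b_le by (intro mult_mono) auto
  moreover have "s ^ 2 * (2 * (a + s) + a) / 6 + a * s ^ 2 / 2 = s ^ 2 * (a + s / 3)"
    by (simp add: field_simps)
  ultimately have "(b - a) ^ 2 * (2 * b + a) / 6 + a * s ^ 2 / 2 \<le> s ^ 2 * (a + s / 3)"
    by linarith
  then show ?thesis
    unfolding bregman_prox_fun[OF assms(1)] a_def b_def s_def
    by (intro mult_left_mono assms(2))
qed

text \<open>
  Along the segment the divergence is at most quadratic in the step length \<open>t\<close>. Its coefficient involves the distances of
  \<open>v\<close> to \<open>x0\<close> and to \<open>y\<close>; uniform convexity turns these back into divergences, which is what lets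
  the energy control its own error terms.
\<close>

lemma bregman_prox_fun_segment:
  assumes "self_adjoint_pos_def B" "0 \<le> \<alpha>" "0 \<le> t" "t \<le> 1"
  shows "bregman (prox_fun B \<alpha> x0) v (v + t *\<^sub>R (y - v)) \<le>
    t ^ 2 * (12 * bregman (prox_fun B \<alpha> x0) v y + bregman (prox_fun B \<alpha> x0) x0 y)"
proof -
  define a s p where "a = bnorm B (v - x0)" and "s = bnorm B (y - v)" and "p = bnorm B (y - x0)"
  have nonneg: "0 \<le> a" "0 \<le> s" "0 \<le> p"
    by (simp_all add: a_def s_def p_def bnorm_nonneg assms)
  have a_le: "a \<le> s + p"
    using bnorm_triangle[OF assms(1), of "v - y" "y - x0"]
    by (simp add: a_def s_def p_def bnorm_minus_commute[of B v y])
  have ts: "bnorm B (t *\<^sub>R (y - v)) = t * s"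
    using assms by (simp add: bnorm_scaleR s_def)
  have amgm: "s ^ 2 * p \<le> (2 * s ^ 3 + p ^ 3) / 3"
  proof -
    have "0 \<le> (s - p) ^ 2 * (2 * s + p)" using nonneg by simp
    then show ?thesis
      by (simp add: power2_eq_square power3_eq_cube algebra_simps)
  qed
  have "bregman (prox_fun B \<alpha> x0) v (v + t *\<^sub>R (y - v)) \<le> \<alpha> * ((t * s) ^ 2 * (a + t * s / 3))"
    using bregman_prox_fun_upper[OF assms(1,2), of x0 v "v + t *\<^sub>R (y - v)"]
    by (simp add: ts a_def)
  also have "\<dots> \<le> \<alpha> * ((t * s) ^ 2 * ((s + p) + s / 3))"
    using assms nonneg a_le mult_right_mono[of t 1 s]
    by (intro mult_left_mono add_mono) auto
  also have "\<dots> = t ^ 2 * (\<alpha> * (4 / 3 * s ^ 3 + s ^ 2 * p))"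
    by (simp add: power2_eq_square power3_eq_cube algebra_simps)
  also have "\<dots> \<le> t ^ 2 * (\<alpha> * (2 * s ^ 3 + p ^ 3 / 3))"
    using amgm assms by (intro mult_left_mono) auto
  also have "\<dots> = t ^ 2 * (12 * (\<alpha> / 6 * s ^ 3) + \<alpha> / 3 * p ^ 3)"
    by (simp add: algebra_simps)
  also have "\<dots> \<le> t ^ 2 * (12 * bregman (prox_fun B \<alpha> x0) v y + bregman (prox_fun B \<alpha> x0) x0 y)"
    using bregman_prox_fun_lower[OF assms(1,2), of y v x0]
    unfolding bregman_prox_fun_center[OF assms(1)] s_def p_def
    by (intro mult_left_mono) auto
  finally show ?thesis .
qed

section \<open>Inexact proximal steps\<close>

text \<open>
  For an exact minimizer the first-order condition would give the inequality with no error. Here approximate optimality is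
  tested at a point of the segment from \<open>v\<close> to \<open>y\<close>, and convexity of \<open>P\<close> extrapolates the result to \<open>y\<close>. By
  the three-point identity, \<open>bregman d w\<close> is affine along the segment up to \<open>bregman d v\<close>.
\<close>

lemma inexact_prox_step_segment:
  assumes conv: "convex_on C P"
    and C: "v \<in> C" "y \<in> C"
    and approx: "\<And>z. z \<in> C \<Longrightarrow> P v + bregman d w v \<le> P z + bregman d w z + \<delta>"
    and t: "0 < t" "t \<le> 1"
  shows "P v + bregman d w v + bregman d v y \<le>
    P y + bregman d w y + (\<delta> + bregman d v (v + t *\<^sub>R (y - v))) / t"
proof -
  define z where "z = v + t *\<^sub>R (y - v)"
  define l where "l = blinfun_apply (grad d v - grad d w) (y - v)"
  have z_eq: "z = (1 - t) *\<^sub>R v + t *\<^sub>R y"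
    by (simp add: z_def algebra_simps)
  have "z \<in> C"
    unfolding z_eq using convex_on_imp_convex[OF conv] C t by (intro convexD) auto
  have "P z \<le> (1 - t) * P v + t * P y"
    unfolding z_eq using conv C t by (intro convex_onD) auto
  moreover have "bregman d w z = bregman d w v + bregman d v z + t * l"
    using bregman_three_points[of d w z v] by (simp add: z_def l_def blinfun.scaleR_right)
  ultimately have "0 \<le> t * (P y - P v + l) + (\<delta> + bregman d v z)"
    using approx[OF \<open>z \<in> C\<close>] by (simp add: algebra_simps)
  then have "0 \<le> P y - P v + l + (\<delta> + bregman d v z) / t"
    using t by (simp add: field_simps)
  then show ?thesis
    using bregman_three_points[of d w y v] unfolding z_def l_def by linarith
qed

text \<open>
  The error \<open>\<delta> / t + t * Q\<close> of the segment inequality is minimal at \<open>t = sqrt (\<delta> / Q)\<close>, unless this exceeds \<open>1\<close>;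
  then the whole segment is used, at a cost of at most \<open>2 * \<delta>\<close>.
\<close>

lemma inexact_prox_step:
  assumes conv: "convex_on C P"
    and C: "v \<in> C" "y \<in> C"
    and approx: "\<And>z. z \<in> C \<Longrightarrow> P v + bregman d w v \<le> P z + bregman d w z + \<delta>"
    and \<delta>: "0 < \<delta>" and Q: "0 \<le> Q"
    and quad: "\<And>t. 0 < t \<Longrightarrow> t \<le> 1 \<Longrightarrow> bregman d v (v + t *\<^sub>R (y - v)) \<le> t ^ 2 * Q"
  shows "P v + bregman d w v + bregman d v y \<le>
    P y + bregman d w y + 2 * \<delta> + 2 * (sqrt \<delta> * sqrt Q)"
proof (cases "Q \<le> \<delta>")
  case True
  have "bregman d v (v + 1 *\<^sub>R (y - v)) \<le> Q" using quad[of 1] by simp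
  then have "P v + bregman d w v + bregman d v y \<le> P y + bregman d w y + (\<delta> + Q)"
    using inexact_prox_step_segment[OF conv C approx, of 1] by simp
  moreover have "0 \<le> sqrt \<delta> * sqrt Q" using \<delta> Q by simp
  ultimately show ?thesis using True by linarith
next
  case False
  then have Q: "\<delta> < Q" "0 < Q" using \<delta> by auto
  define t where "t = sqrt \<delta> / sqrt Q"
  have t: "0 < t" "t \<le> 1" using Q \<delta> by (auto simp: t_def)
  have "(\<delta> + bregman d v (v + t *\<^sub>R (y - v))) / t \<le> (\<delta> + t ^ 2 * Q) / t"
    using quad[OF t] t by (intro divide_right_mono) auto
  also have "t ^ 2 * Q = \<delta>"
    using Q \<delta> by (simp add: t_def power_divide)
  also have "(\<delta> + \<delta>) / t = 2 * (sqrt \<delta> * sqrt Q)"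
    using Q \<delta> by (simp add: t_def field_simps)
  finally show ?thesis
    using inexact_prox_step_segment[OF conv C approx t] \<delta> by linarith
qed

section \<open>Convexity of the composite objective\<close>

lemma phi_finite:
  assumes "outer_function F" "x \<in> dom_phi F f D"
  shows "phi F f D x = ereal (real_of_ereal (phi F f D x))"
proof -
  have "F x (f x) \<noteq> -\<infinity>" using assms(1) by (simp add: outer_function_def)
  then show ?thesis
    using assms(2) by (cases "F x (f x)") (auto simp: phi_def dom_phi_def)
qed

text \<open>
  Joint convexity of \<open>F\<close> bounds \<open>F z c\<close>, where \<open>c\<close> is the convex combination of the inner values, and convexity of \<open>f\<close> gives \<open>f z \<le> c\<close>.
  Monotonicity of \<open>F z\<close> then passes to \<open>F z (f z)\<close>; since it covers infinite values,
  the same argument shows that the domain is convex.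
\<close>

lemma phi_convex:
  fixes F :: "'a::euclidean_space \<Rightarrow> real^'m \<Rightarrow> ereal"
  assumes F: "outer_function F" and f: "inner_function f D"
  shows "convex_on (dom_phi F f D) (\<lambda>x. real_of_ereal (phi F f D x))"
proof -
  define g where "g = (\<lambda>x. real_of_ereal (phi F f D x))"
  have fin: "F x (f x) = ereal (g x)" if "x \<in> dom_phi F f D" for x
    using phi_finite[OF F that] that by (simp add: g_def phi_def dom_phi_def)
  have comb: "u *\<^sub>R x + w *\<^sub>R y \<in> dom_phi F f D \<and> g (u *\<^sub>R x + w *\<^sub>R y) \<le> u * g x + w * g y"
    if x: "x \<in> dom_phi F f D" and y: "y \<in> dom_phi F f D"
      and uw: "0 \<le> u" "0 \<le> w" "u + w = 1" for x y u w
  proof -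
    define z where "z = u *\<^sub>R x + w *\<^sub>R y"
    define c where "c = u *\<^sub>R f x + w *\<^sub>R f y"
    have xy: "x \<in> D" "y \<in> D" using x y by (auto simp: dom_phi_def)
    have "z \<in> D"
      unfolding z_def using f xy uw by (intro convexD) (auto simp: inner_function_def)
    have "convex (ereal_epigraph (\<lambda>(x, u). F x u))"
      using F by (simp add: outer_function_def closed_convex_def)
    moreover have "((x, f x), g x) \<in> ereal_epigraph (\<lambda>(x, u). F x u)"
      "((y, f y), g y) \<in> ereal_epigraph (\<lambda>(x, u). F x u)"
      using fin x y by (auto simp: ereal_epigraph_def)
    ultimately have "u *\<^sub>R ((x, f x), g x) + w *\<^sub>R ((y, f y), g y) \<in> ereal_epigraph (\<lambda>(x, u). F x u)"
      using uw by (intro convexD) auto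
    then have Fc: "F z c \<le> ereal (u * g x + w * g y)"
      by (auto simp: ereal_epigraph_def z_def c_def)
    then have "F z c < \<infinity>" by (rule le_less_trans) simp
    then have mono: "mono (F z)"
      using F by (auto simp: outer_function_def)
    have "f z \<le> c"
      unfolding less_eq_vec_def
    proof
      fix i
      have "convex_on D (\<lambda>x. f x $ i)" using f by (simp add: inner_function_def)
      then have "f (u *\<^sub>R x + w *\<^sub>R y) $ i \<le> u * f x $ i + w * f y $ i"
        using xy uw unfolding convex_on_def by blast
      then show "f z $ i \<le> c $ i" by (simp add: z_def c_def)
    qed
    then have "F z (f z) \<le> F z c" using mono by (rule monoD[rotated])
    then have le: "F z (f z) \<le> ereal (u * g x + w * g y)" using Fc by (rule order_trans)
    then have "F z (f z) < \<infinity>" by (rule le_less_trans) simp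
    then have "z \<in> dom_phi F f D" using \<open>z \<in> D\<close> by (simp add: dom_phi_def)
    then show ?thesis using le fin by (simp add: z_def)
  qed
  then show ?thesis
    unfolding convex_on_def convex_def g_def by blast
qed

text \<open>
  Adding \<open>L\<close> to the argument can only increase \<open>F x\<close>, while by subhomogeneity it increases \<open>F x\<close> by at most
  \<open>F x L\<close>; so \<open>F x L\<close> is nonnegative already at a single point of the domain.
\<close>

lemma outer_const_nonneg:
  fixes F :: "'a::euclidean_space \<Rightarrow> real^'m \<Rightarrow> ereal"
  assumes "outer_function F" "subhomogeneous F f D" "x \<in> dom_phi F f D" "0 \<le> L"
  shows "0 \<le> outer_const F f D L"
proof -
  have "F x (f x) \<noteq> -\<infinity>" "F x (f x) < \<infinity>"
    using assms(1,3) by (auto simp: outer_function_def dom_phi_def)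
  then obtain r where r: "F x (f x) = ereal r" by (cases "F x (f x)") auto
  then have "mono (F x)"
    using assms(1) \<open>F x (f x) < \<infinity>\<close> unfolding outer_function_def by blast
  then have "F x (f x) \<le> F x (f x + 1 *\<^sub>R L)"
    by (rule monoD) (use assms(4) in simp)
  also have "\<dots> \<le> F x (f x) + ereal 1 * F x L"
    using assms(2,3) unfolding subhomogeneous_def by (meson zero_le_one)
  finally have "0 \<le> F x L"
    by (cases "F x L") (auto simp: r)
  also have "\<dots> \<le> outer_const F f D L"
    unfolding outer_const_def by (rule SUP_upper[OF assms(3)])
  finally show ?thesis .
qed

section \<open>Growth of the energy\<close>

text \<open>
  Completing the square turns the implicit inequality into one between \<open>(sqrt q - 12 * e)\<^sup>2\<close> and
  \<open>p + 168 * e\<^sup>2\<close>; the constant is \<open>25 = 12 + 13\<close> because \<open>168 \<le> 13\<^sup>2\<close>.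
\<close>

lemma sqrt_growth_step:
  fixes e p q :: real
  assumes "0 \<le> e" "0 \<le> p" "0 \<le> q" and le: "q \<le> p + 24 * e ^ 2 + 24 * (e * sqrt q)"
  shows "sqrt q \<le> sqrt p + 25 * e"
proof -
  have "sqrt q ^ 2 = q" "sqrt p ^ 2 = p" using assms by simp_all
  then have "(sqrt q - 12 * e) ^ 2 \<le> sqrt p ^ 2 + 168 * e ^ 2"
    using le by (simp add: power2_diff power_mult_distrib algebra_simps)
  also have "\<dots> \<le> (sqrt p + 13 * e) ^ 2"
    using assms by (simp add: power2_sum power_mult_distrib)
  finally have "sqrt q - 12 * e \<le> sqrt p + 13 * e"
    by (rule power2_le_imp_le) (use assms in simp)
  then show ?thesis by simp
qed

text \<open>
  In the variable \<open>sqrt (12 * E k + \<rho>)\<close>, which starts at \<open>sqrt (13 * \<rho>)\<close>, the growth is linear. Squaring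
  produces the mixed term in \<open>sqrt \<delta> * sqrt \<rho>\<close>.
\<close>

lemma energy_growth:
  fixes E :: "nat \<Rightarrow> real"
  assumes "0 \<le> \<delta>" and init: "E 0 = \<rho>" and nonneg: "\<And>k. 0 \<le> E k"
    and step: "\<And>k. E (Suc k) \<le> E k + 2 * \<delta> + 2 * (sqrt \<delta> * sqrt (12 * E (Suc k) + \<rho>))"
  shows "E k \<le> \<rho> + 17 * real k * (sqrt \<delta> * sqrt \<rho>) + 53 * real k ^ 2 * \<delta>"
proof -
  have \<rho>: "0 \<le> \<rho>" using init nonneg[of 0] by simp
  define c where "c = sqrt (13 * \<rho>) + 25 * real k * sqrt \<delta>"
  have "sqrt (12 * E j + \<rho>) \<le> sqrt (13 * \<rho>) + 25 * real j * sqrt \<delta>" for j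
  proof (induction j)
    case 0
    then show ?case by (simp add: init)
  next
    case (Suc j)
    have "sqrt (12 * E (Suc j) + \<rho>) \<le> sqrt (12 * E j + \<rho>) + 25 * sqrt \<delta>"
      using step[of j] nonneg[of j] nonneg[of "Suc j"] \<rho> assms(1)
      by (intro sqrt_growth_step) auto
    then show ?case using Suc by (simp add: algebra_simps)
  qed
  then have "sqrt (12 * E k + \<rho>) \<le> c" by (simp add: c_def)
  then have "12 * E k + \<rho> \<le> c ^ 2"
    by (rule sqrt_le_D)
  also have "c ^ 2 = 13 * \<rho> + 50 * real k * sqrt \<delta> * (sqrt 13 * sqrt \<rho>) + 625 * real k ^ 2 * \<delta>"
    using \<rho> assms(1) by (simp add: c_def power2_sum power_mult_distrib real_sqrt_mult)
  \<comment> \<open>The crude bound \<open>sqrt 13 \<le> 4\<close> keeps the coefficients integral.\<close>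
  also have "\<dots> \<le> 13 * \<rho> + 50 * real k * sqrt \<delta> * (4 * sqrt \<rho>) + 625 * real k ^ 2 * \<delta>"
    using \<rho> assms(1)
    by (intro add_mono mult_left_mono mult_right_mono real_le_lsqrt) auto
  finally have "12 * E k \<le> 12 * \<rho> + 200 * (real k * (sqrt \<delta> * sqrt \<rho>)) + 625 * (real k ^ 2 * \<delta>)"
    by simp
  moreover have "0 \<le> real k * (sqrt \<delta> * sqrt \<rho>)" "0 \<le> real k ^ 2 * \<delta>"
    using \<rho> assms(1) by simp_all
  ultimately show ?thesis by linarith
qed

section \<open>The contracting scheme\<close>

lemma A_seq_Suc_pos: "0 < A_seq (Suc k)"
  by (simp add: A_seq_def)

lemma A_seq_nonneg: "0 \<le> A_seq k"
  by (simp add: A_seq_def)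

lemma A_seq_gamma_seq:
  shows "A_seq (Suc k) * (1 - gamma_seq k) = A_seq k"
    and "A_seq (Suc k) * gamma_seq k = A_seq (Suc k) - A_seq k"
  using A_seq_Suc_pos[of k] by (simp_all add: gamma_seq_def field_simps)

lemma gamma_seq_bounds: "0 \<le> gamma_seq k" "gamma_seq k \<le> 1"
proof -
  have "A_seq k \<le> A_seq (Suc k)"
    by (simp add: A_seq_def power_mono divide_right_mono)
  then show "0 \<le> gamma_seq k" "gamma_seq k \<le> 1"
    using A_seq_Suc_pos[of k] A_seq_nonneg[of k] by (auto simp: gamma_seq_def)
qed

lemma contract_affine:
  assumes "u + w = 1"
  shows "contract k y (u *\<^sub>R p + w *\<^sub>R q) = u *\<^sub>R contract k y p + w *\<^sub>R contract k y q"
proof -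
  have "(1 - gamma_seq k) *\<^sub>R y = u *\<^sub>R ((1 - gamma_seq k) *\<^sub>R y) + w *\<^sub>R ((1 - gamma_seq k) *\<^sub>R y)"
    by (metis assms scaleR_left_distrib scaleR_one)
  then show ?thesis
    by (simp add: contract_def algebra_simps)
qed

lemma convex_on_contract:
  assumes "convex_on S g"
  shows "convex_on {z. contract k y z \<in> S} (\<lambda>z. A_seq (Suc k) * g (contract k y z))"
proof -
  have "convex_on {z. contract k y z \<in> S} (\<lambda>z. g (contract k y z))"
    using assms unfolding convex_on_def convex_def by (auto simp: contract_affine)
  then show ?thesis
    using A_seq_nonneg by (rule convex_on_cmul[rotated])
qed

lemma convex_on_contract_le:
  assumes "convex_on S g" "y \<in> S" "z \<in> S"
  shows "contract k y z \<in> S"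
    and "A_seq (Suc k) * g (contract k y z) \<le> A_seq k * g y + (A_seq (Suc k) - A_seq k) * g z"
proof -
  show "contract k y z \<in> S"
    unfolding contract_def using convex_on_imp_convex[OF assms(1)] assms gamma_seq_bounds
    by (intro convexD) auto
  have "g (contract k y z) \<le> gamma_seq k * g z + (1 - gamma_seq k) * g y"
    using assms gamma_seq_bounds[of k] unfolding contract_def convex_on_def by auto
  then have "A_seq (Suc k) * g (contract k y z) \<le>
      A_seq (Suc k) * (gamma_seq k * g z + (1 - gamma_seq k) * g y)"
    by (intro mult_left_mono A_seq_nonneg)
  also have "\<dots> = A_seq k * g y + (A_seq (Suc k) - A_seq k) * g z"
    unfolding distrib_left mult.assoc[symmetric] A_seq_gamma_seq by simp
  finally show "A_seq (Suc k) * g (contract k y z) \<le>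
      A_seq k * g y + (A_seq (Suc k) - A_seq k) * g z" .
qed

text \<open>
  Passage from the extended-valued condition on \<open>v\<close> to real numbers: a single \<open>z\<close> with finite \<open>h\<close>
  forces \<open>h\<close> to be finite at \<open>v\<close>, so that the contraction of \<open>v\<close> lies in the domain.
\<close>

lemma h_fun_approx_min:
  fixes F :: "'a::euclidean_space \<Rightarrow> real^'m \<Rightarrow> ereal"
    and f :: "'a \<Rightarrow> real^'m" and D :: "'a set"
  defines "g \<equiv> \<lambda>x. real_of_ereal (phi F f D x)"
  assumes F: "outer_function F"
    and approx: "h_fun F f D d k y w v - (INF z. h_fun F f D d k y w z) \<le> ereal \<delta>"
    and z: "contract k y z \<in> dom_phi F f D"
  shows "contract k y v \<in> dom_phi F f D"
    and "A_seq (Suc k) * g (contract k y v) + bregman d w v \<le>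
      A_seq (Suc k) * g (contract k y z) + bregman d w z + \<delta>"
proof -
  have h: "h_fun F f D d k y w z = ereal (A_seq (Suc k) * g (contract k y z) + bregman d w z)"
    if "contract k y z \<in> dom_phi F f D" for z
    unfolding h_fun_def g_def by (subst phi_finite[OF F that]) simp
  have "(INF z. h_fun F f D d k y w z) \<le> h_fun F f D d k y w z"
    by (rule INF_lower) simp
  then have le: "h_fun F f D d k y w v \<le>
      ereal (A_seq (Suc k) * g (contract k y z) + bregman d w z + \<delta>)"
    using approx unfolding h[OF z]
    by (cases "h_fun F f D d k y w v"; cases "INF z. h_fun F f D d k y w z") auto
  have "phi F f D (contract k y v) \<noteq> \<infinity>"
  proof
    assume "phi F f D (contract k y v) = \<infinity>"
    then have "h_fun F f D d k y w v = \<infinity>"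
      using A_seq_Suc_pos[of k] by (simp add: h_fun_def)
    then show False using le by simp
  qed
  then show v: "contract k y v \<in> dom_phi F f D"
    by (auto simp: phi_def dom_phi_def less_top split: if_splits)
  show "A_seq (Suc k) * g (contract k y v) + bregman d w v \<le>
      A_seq (Suc k) * g (contract k y z) + bregman d w z + \<delta>"
    using le unfolding h[OF v] by simp
qed

text \<open>
  The weights satisfy \<open>A_seq (k + 1) * (1 - gamma_seq k) = A_seq k\<close>, so convexity of \<open>\<phi>\<close> bounds the
  contracted objective at \<open>xs\<close> by exactly the share of the old iterate in the energy plus the increment of the weight
  times the optimal value. Together with the inexact proximal step from \<open>v k\<close> to \<open>v (k + 1)\<close>, this
  makes the energy satisfy the recurrence of \<open>energy_growth\<close>.
\<close>

lemma scheme_energy_bound: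
  fixes F :: "'a::euclidean_space \<Rightarrow> real^'m \<Rightarrow> ereal"
    and f :: "'a \<Rightarrow> real^'m" and D :: "'a set"
  defines "g \<equiv> \<lambda>x. real_of_ereal (phi F f D x)"
  assumes B: "self_adjoint_pos_def B" and F: "outer_function F" and f: "inner_function f D"
    and \<alpha>: "0 \<le> \<alpha>" and \<delta>: "0 < \<delta>"
    and xs: "xs \<in> dom_phi F f D" "phi F f D xs = phi_star F f D"
    and d: "d = prox_fun B \<alpha> (x 0)"
    and scheme: "contracting_prox_scheme B F f D d \<delta> a x v"
    and \<rho>: "\<rho> = bregman d (x 0) xs"
  shows "x k \<in> dom_phi F f D"
    and "A_seq k * (g (x k) - g xs) + bregman d (v k) xs \<le>
      \<rho> + 17 * real k * (sqrt \<delta> * sqrt \<rho>) + 53 * real k ^ 2 * \<delta>"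
proof -
  let ?S = "dom_phi F f D"
  have conv: "convex_on ?S g"
    using phi_convex[OF F f] by (simp add: g_def)
  have x_Suc: "x (Suc k) = contract k (x k) (v (Suc k))" for k
    using scheme by (simp add: contracting_prox_scheme_def)
  have approx: "h_fun F f D d k (x k) (v k) (v (Suc k)) -
      (INF y. h_fun F f D d k (x k) (v k) y) \<le> ereal \<delta>" for k
    using scheme by (simp add: contracting_prox_scheme_def)
  have x: "x k \<in> ?S" for k
  proof (induction k)
    case 0
    then show ?case using scheme by (simp add: contracting_prox_scheme_def)
  next
    case (Suc k)
    then show ?case
      using h_fun_approx_min(1)[OF F approx convex_on_contract_le(1)[OF conv Suc xs(1)]]
      by (simp add: x_Suc)
  qed
  then show "x k \<in> ?S" .
  have opt: "g xs \<le> g z" if "z \<in> ?S" for z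
  proof -
    have "phi F f D xs \<le> phi F f D z"
      unfolding xs(2) phi_star_def by (rule INF_lower[OF that])
    then show ?thesis
      using phi_finite[OF F xs(1)] phi_finite[OF F that] unfolding g_def by (metis ereal_less_eq(3))
  qed
  have d_nonneg: "0 \<le> bregman d w y" for w y
    unfolding d by (rule bregman_prox_fun_nonneg[OF B \<alpha>])
  define E where "E = (\<lambda>k. A_seq k * (g (x k) - g xs) + bregman d (v k) xs)"
  have E_ge: "bregman d (v k) xs \<le> E k" for k
    using A_seq_nonneg[of k] opt[OF x[of k]] by (simp add: E_def)
  have "E k \<le> \<rho> + 17 * real k * (sqrt \<delta> * sqrt \<rho>) + 53 * real k ^ 2 * \<delta>"
  proof (rule energy_growth)
    show "0 \<le> \<delta>" using \<delta> by simp
    show "E 0 = \<rho>"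
      using scheme by (simp add: E_def A_seq_def \<rho> contracting_prox_scheme_def)
    show "0 \<le> E k" for k
      using E_ge[of k] d_nonneg[of "v k" xs] by linarith
    show "E (Suc k) \<le> E k + 2 * \<delta> + 2 * (sqrt \<delta> * sqrt (12 * E (Suc k) + \<rho>))" for k
    proof -
      let ?P = "\<lambda>z. A_seq (Suc k) * g (contract k (x k) z)"
      let ?C = "{z. contract k (x k) z \<in> ?S}"
      define Q where "Q = 12 * bregman d (v (Suc k)) xs + \<rho>"
      have "?P (v (Suc k)) + bregman d (v k) (v (Suc k)) + bregman d (v (Suc k)) xs \<le>
          ?P xs + bregman d (v k) xs + 2 * \<delta> + 2 * (sqrt \<delta> * sqrt Q)"
      proof (rule inexact_prox_step)
        show "convex_on ?C ?P" by (rule convex_on_contract[OF conv])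
        show "v (Suc k) \<in> ?C" using x[of "Suc k"] by (simp add: x_Suc)
        show "xs \<in> ?C" using convex_on_contract_le(1)[OF conv x xs(1)] by simp
        show "?P (v (Suc k)) + bregman d (v k) (v (Suc k)) \<le> ?P z + bregman d (v k) z + \<delta>"
          if "z \<in> ?C" for z
          using h_fun_approx_min(2)[OF F approx] that by (simp add: g_def)
        show "0 < \<delta>" by fact
        show "0 \<le> Q" using d_nonneg by (simp add: Q_def \<rho>)
        show "bregman d (v (Suc k)) (v (Suc k) + t *\<^sub>R (xs - v (Suc k))) \<le> t ^ 2 * Q"
          if "0 < t" "t \<le> 1" for t
          using bregman_prox_fun_segment[OF B \<alpha>, of t] that by (simp add: Q_def \<rho> d)
      qed
      moreover have "?P xs \<le> A_seq k * g (x k) + (A_seq (Suc k) - A_seq k) * g xs"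
        by (rule convex_on_contract_le(2)[OF conv x xs(1)])
      moreover have "sqrt \<delta> * sqrt Q \<le> sqrt \<delta> * sqrt (12 * E (Suc k) + \<rho>)"
        using E_ge[of "Suc k"] \<delta> by (intro mult_left_mono) (auto simp: Q_def)
      ultimately show ?thesis
        using d_nonneg[of "v k" "v (Suc k)"]
        by (simp add: E_def x_Suc algebra_simps)
    qed
  qed
  then show "A_seq k * (g (x k) - g xs) + bregman d (v k) xs \<le>
      \<rho> + 17 * real k * (sqrt \<delta> * sqrt \<rho>) + 53 * real k ^ 2 * \<delta>"
    by (simp add: E_def)
qed

text \<open>
  Each of the three terms is made at most \<open>\<epsilon> / 3\<close>: the first by \<open>k\<close>, the second by \<open>\<delta> \<lesssim> \<epsilon>\<close> and the third by
  \<open>\<delta> \<lesssim> \<epsilon>\<^sup>2 / \<rho>\<close>. The third, of order \<open>sqrt \<delta>\<close>, is why \<open>approx_const\<close> is the square of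
  \<open>1 / (3 * O_const)\<close>.
\<close>

lemma delta_level_suffices:
  assumes "0 < \<epsilon>" "0 < \<delta>" "0 \<le> \<rho>" "1 \<le> k"
    and \<delta>: "ereal \<delta> \<le> ereal approx_const * delta_level \<epsilon> \<rho>"
    and k: "3 * O_const * \<rho> / \<epsilon> \<le> real k ^ 3"
  shows "O_const * (\<rho> / real k ^ 3 + \<delta> + sqrt \<delta> * sqrt \<rho>) \<le> \<epsilon>"
proof -
  have c: "0 < approx_const" "O_const = 10000" by (simp_all add: approx_const_def O_const_def)
  have "ereal approx_const * delta_level \<epsilon> \<rho> \<le> ereal approx_const * ereal \<epsilon>"
    using c by (intro ereal_mult_left_mono) (auto simp: delta_level_def)
  then have "\<delta> \<le> approx_const * \<epsilon>" using \<delta> by (metis order_trans times_ereal.simps(1) ereal_less_eq(3))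
  then have 1: "O_const * \<delta> \<le> \<epsilon> / 3"
    using assms by (simp add: O_const_def approx_const_def)
  have 2: "O_const * (sqrt \<delta> * sqrt \<rho>) \<le> \<epsilon> / 3"
  proof (cases "\<rho> = 0")
    case True
    then show ?thesis using assms by simp
  next
    case False
    then have "\<rho> > 0" using assms by simp
    have "ereal approx_const * delta_level \<epsilon> \<rho> \<le> ereal approx_const * (ereal (\<epsilon> ^ 2) / ereal \<rho>)"
      using c by (intro ereal_mult_left_mono) (auto simp: delta_level_def)
    with \<delta> have "ereal \<delta> \<le> ereal approx_const * (ereal (\<epsilon> ^ 2) / ereal \<rho>)"
      by (rule order_trans)
    then have "ereal \<delta> \<le> ereal (approx_const * (\<epsilon> ^ 2 / \<rho>))"
      using \<open>\<rho> > 0\<close> by simp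
    then have "\<delta> * \<rho> \<le> approx_const * \<epsilon> ^ 2"
      using \<open>\<rho> > 0\<close> by (simp add: field_simps)
    also have "\<dots> = (\<epsilon> / (3 * O_const)) ^ 2"
      by (simp add: approx_const_def power_divide)
    finally have "sqrt (\<delta> * \<rho>) \<le> \<epsilon> / (3 * O_const)"
      using assms c by (intro real_le_lsqrt) auto
    then show ?thesis by (simp add: O_const_def real_sqrt_mult)
  qed
  have "O_const * (\<rho> / real k ^ 3) \<le> \<epsilon> / 3"
    using k assms c by (simp add: field_simps)
  then show ?thesis using 1 2 unfolding distrib_left by linarith
qed

lemma delta_level_necessary:
  assumes "0 < \<epsilon>" "0 < \<delta>" "0 \<le> \<rho>"
    and le: "O_const * (\<rho> / real k ^ 3 + \<delta> + sqrt \<delta> * sqrt \<rho>) \<le> \<epsilon>"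
  shows "ereal \<delta> \<le> delta_level \<epsilon> \<rho>"
proof -
  have O: "O_const = 10000" by (simp add: O_const_def)
  have nonneg: "0 \<le> \<rho> / real k ^ 3" "0 \<le> sqrt \<delta> * sqrt \<rho>"
    using assms by simp_all
  then have "\<delta> \<le> \<epsilon>" "sqrt \<delta> * sqrt \<rho> \<le> \<epsilon>"
    using le assms(1,2) by (simp_all add: O)
  moreover have "ereal \<delta> \<le> ereal (\<epsilon> ^ 2) / ereal \<rho>"
  proof (cases "\<rho> = 0")
    case True
    then show ?thesis using assms by simp
  next
    case False
    then have "\<rho> > 0" using assms by simp
    have "(sqrt \<delta> * sqrt \<rho>) ^ 2 \<le> \<epsilon> ^ 2"
      using \<open>sqrt \<delta> * sqrt \<rho> \<le> \<epsilon>\<close> nonneg by (intro power_mono) auto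
    then have "\<delta> * \<rho> \<le> \<epsilon> ^ 2"
      using assms by (simp add: power_mult_distrib)
    then show ?thesis using \<open>\<rho> > 0\<close> by (simp add: field_simps)
  qed
  ultimately show ?thesis by (simp add: delta_level_def)
qed

theorem corollary1:
  fixes B :: "'a::euclidean_space \<Rightarrow>\<^sub>L 'a \<Rightarrow>\<^sub>L real"
    and F :: "'a \<Rightarrow> real^'m \<Rightarrow> ereal"
    and f :: "'a \<Rightarrow> real^'m"
    and D :: "'a set"
    and L2 :: "real^'m"
    and \<alpha> \<delta> a :: real
    and xs :: 'a
    and x v :: "nat \<Rightarrow> 'a"
    and d :: "'a \<Rightarrow> real"
    and \<rho>0 :: real
  assumes "self_adjoint_pos_def B"
    and "outer_function F"
    and "inner_function f D"
    and "\<forall>i. hess_lipschitz B D (\<lambda>y. f y $ i) (L2 $ i)"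
    and "subhomogeneous F f D"
    and "ereal \<alpha> = outer_const F f D L2"
    and "xs \<in> dom_phi F f D" and "phi F f D xs = phi_star F f D"
    and "\<delta> > 0" and "a \<ge> 1"
    and "d = prox_fun B \<alpha> (x 0)"
    and "contracting_prox_scheme B F f D d \<delta> a x v"
    and "\<rho>0 = bregman d (x 0) xs"
  shows "(\<forall>k\<ge>1.
            ereal (A_seq k) * (phi F f D (x k) - phi_star F f D) + ereal (bregman d (v k) xs)
              \<le> ereal (O_const * (\<rho>0 + real k ^ 3 * \<delta> + real k ^ 3 * (sqrt \<delta> * sqrt \<rho>0)))) \<and>
         (\<forall>k\<ge>1.
            phi F f D (x k) - phi_star F f D
              \<le> ereal (O_const * (\<rho>0 / real k ^ 3 + \<delta> + sqrt \<delta> * sqrt \<rho>0))) \<and>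
         (\<forall>\<epsilon>>0.
            (ereal \<delta> \<le> ereal approx_const * delta_level \<epsilon> \<rho>0 \<longrightarrow>
               (\<forall>k\<ge>1. 3 * O_const * \<rho>0 / \<epsilon> \<le> real k ^ 3 \<longrightarrow>
                  phi F f D (x k) - phi_star F f D \<le> ereal \<epsilon>)) \<and>
            (\<forall>k\<ge>1. O_const * (\<rho>0 / real k ^ 3 + \<delta> + sqrt \<delta> * sqrt \<rho>0) \<le> \<epsilon> \<longrightarrow>
               ereal \<delta> \<le> delta_level \<epsilon> \<rho>0))"
proof -
  have "0 \<le> L2"
    using assms(4) by (simp add: less_eq_vec_def hess_lipschitz_def)
  then have \<alpha>: "0 \<le> \<alpha>"
    using outer_const_nonneg[OF assms(2,5,7), of L2] by (simp flip: assms(6))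
  have \<rho>0: "0 \<le> \<rho>0"
    unfolding assms(11,13) by (rule bregman_prox_fun_nonneg[OF assms(1) \<alpha>])
  define G where "G = (\<lambda>k. real_of_ereal (phi F f D (x k)) - real_of_ereal (phi F f D xs))"
  note energy = scheme_energy_bound[OF assms(1-3) \<alpha> assms(9,7,8,11,12,13)]
  have gap: "phi F f D (x k) - phi_star F f D = ereal (G k)" for k
    using phi_finite[OF assms(2) energy(1)[of k]] phi_finite[OF assms(2,7)]
    unfolding assms(8)[symmetric] G_def by (metis ereal_minus(1))
  \<comment> \<open>The constant \<open>60\<close> leaves room for the factor \<open>27\<close> from \<open>A_seq k = k\<^sup>3 / 27\<close>: \<open>60 * 27 = 1620\<close>.\<close>
  have energy_le: "A_seq k * G k + bregman d (v k) xs \<le>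
      60 * (\<rho>0 + real k ^ 3 * \<delta> + real k ^ 3 * (sqrt \<delta> * sqrt \<rho>0))" if "1 \<le> k" for k
  proof -
    have "real k ^ 1 \<le> real k ^ 3" "real k ^ 2 \<le> real k ^ 3"
      using that by (intro power_increasing; simp)+
    then have "real k * (sqrt \<delta> * sqrt \<rho>0) \<le> real k ^ 3 * (sqrt \<delta> * sqrt \<rho>0)"
      "real k ^ 2 * \<delta> \<le> real k ^ 3 * \<delta>"
      using \<rho>0 assms(9) by (auto intro!: mult_right_mono)
    moreover have "0 \<le> real k ^ 3 * (sqrt \<delta> * sqrt \<rho>0)" "0 \<le> real k ^ 3 * \<delta>"
      using \<rho>0 assms(9) by simp_all
    ultimately show ?thesis
      using energy(2)[of k] \<rho>0 unfolding G_def distrib_left by linarith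
  qed
  have 1: "A_seq k * G k + bregman d (v k) xs \<le>
      O_const * (\<rho>0 + real k ^ 3 * \<delta> + real k ^ 3 * (sqrt \<delta> * sqrt \<rho>0))" if "1 \<le> k" for k
    by (rule order_trans[OF energy_le[OF that] mult_right_mono])
      (use \<rho>0 assms(9) in \<open>auto simp: O_const_def\<close>)
  have 2: "G k \<le> O_const * (\<rho>0 / real k ^ 3 + \<delta> + sqrt \<delta> * sqrt \<rho>0)" if "1 \<le> k" for k
  proof -
    have k: "0 < real k ^ 3" using that by simp
    have "0 \<le> bregman d (v k) xs"
      unfolding assms(11) by (rule bregman_prox_fun_nonneg[OF assms(1) \<alpha>])
    then have "real k ^ 3 * G k \<le>
        1620 * (\<rho>0 + real k ^ 3 * \<delta> + real k ^ 3 * (sqrt \<delta> * sqrt \<rho>0))"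
      using energy_le[OF that] by (simp add: A_seq_def power_divide)
    also have "\<dots> = real k ^ 3 * (1620 * (\<rho>0 / real k ^ 3 + \<delta> + sqrt \<delta> * sqrt \<rho>0))"
      using k by (simp add: field_simps)
    finally have "G k \<le> 1620 * (\<rho>0 / real k ^ 3 + \<delta> + sqrt \<delta> * sqrt \<rho>0)"
      using k by simp
    also have "\<dots> \<le> O_const * (\<rho>0 / real k ^ 3 + \<delta> + sqrt \<delta> * sqrt \<rho>0)"
      using \<rho>0 assms(9) by (intro mult_right_mono) (auto simp: O_const_def)
    finally show ?thesis .
  qed
  have 3: "G k \<le> \<epsilon>"
    if "\<epsilon> > 0" "ereal \<delta> \<le> ereal approx_const * delta_level \<epsilon> \<rho>0" "1 \<le> k"
      "3 * O_const * \<rho>0 / \<epsilon> \<le> real k ^ 3" for k \<epsilon>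
    using 2[OF that(3)] delta_level_suffices[OF that(1) assms(9) \<rho>0 that(3,2,4)]
    by (rule order_trans)
  show ?thesis
    unfolding gap using 1 2 3 delta_level_necessary[OF _ assms(9) \<rho>0] by auto
qed

end
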